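(* Let $f:[0,1]\to[0,1]$ be an increasing bijection, and let $X_1,X_2,\ldots$ be i.i.d. random variables uniformly distributed on $[0,1]$. Let $\mu_f$ be the expected value of $f(X_i)$ (the same for each $i$). For $t\ge 0$, let $K_f=K_f(t)$ be the minimal positive integer such that $\sum_{i=1}^{K_f} f(X_i)>t$, and let $N_f(t)$ be the expected value of $K_f$. Put $$c_f=\frac{\int_0^1\int_{f^{-1}(u)}^1 (f(x)-u)\,dx\,du}{\mu_f}.$$ Then $$N_f(t)=\frac{t+c_f}{\mu_f}+o(1).$$
   Context: Here $o(1)$ denotes a quantity tending to $0$ as $t\to\infty$ (with $f$ fixed). *)

theory Defs
  imports "HOL-Probability.Probability"
begin

definition mean_step :: "'a measure \<Rightarrow> (real \<Rightarrow> real) \<Rightarrow> (nat \<Rightarrow> 'a \<Rightarrow> real) \<Rightarrow> real" where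
  "mean_step M f X = (LINT \<omega>|M. f (X 1 \<omega>))"

text \<open>The stopping time is extended-valued: on the (null) event that the partial sums never
  exceed \<open>t\<close>, the infimum of the empty set is \<open>\<infinity>\<close>. Its expectation is therefore taken in
  \<^typ>\<open>ennreal\<close>, so that a non-integrable stopping time has expectation \<open>\<infinity>\<close> and not \<open>0\<close>.
  The sequence of random variables is indexed from 1; \<open>X 0\<close> is never used.\<close>

definition stop_time :: "(real \<Rightarrow> real) \<Rightarrow> (nat \<Rightarrow> 'a \<Rightarrow> real) \<Rightarrow> real \<Rightarrow> 'a \<Rightarrow> enat" where
  "stop_time f X t \<omega> = (INF k \<in> {k. k \<ge> 1 \<and> (\<Sum>i=1..k. f (X i \<omega>)) > t}. enat k)"

definition expected_stop ::
    "'a measure \<Rightarrow> (real \<Rightarrow> real) \<Rightarrow> (nat \<Rightarrow> 'a \<Rightarrow> real) \<Rightarrow> real \<Rightarrow> ennreal" where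
  "expected_stop M f X t = (\<integral>\<^sup>+\<omega>. ennreal_of_enat (stop_time f X t \<omega>) \<partial>M)"

definition c_const :: "'a measure \<Rightarrow> (real \<Rightarrow> real) \<Rightarrow> (nat \<Rightarrow> 'a \<Rightarrow> real) \<Rightarrow> real" where
  "c_const M f X =
     (LBINT u:{0..1}. (LBINT x:{inv_into {0..1} f u..1}. f x - u)) / mean_step M f X"

end

theory Submission
  imports Defs
begin

text \<open>
Write \<open>Y = f (X 1)\<close>, \<open>\<mu> = E Y\<close>, and \<open>N t\<close> for the expected stopping time. The assertion is the
renewal theorem in the sharp form \<open>\<mu> N t - t \<longlongrightarrow> E Y\<^sup>2 / (2 \<mu>)\<close>: exchanging the order of integration shows
that the double integral in the constant \<open>c_const\<close> is \<open>E Y\<^sup>2 / 2\<close>.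
Because \<open>f\<close> is an increasing bijection, the law of \<open>Y\<close> has no atoms and charges every subinterval of
\<open>[0,1]\<close>. For such laws there is a short proof by a maximum principle.

Since the partial sums \<open>S n\<close> do not decrease, \<open>N t\<close> is the sum of the probabilities
\<open>P (S n \<le> t)\<close> over \<open>n \<ge> 0\<close>. These decay geometrically, which gives finiteness and continuity of
\<open>N\<close>. Conditioning on the first step gives the renewal equation \<open>N t = 1 + E (N (t - Y))\<close> for \<open>t \<ge> 0\<close>,
with \<open>N = 0\<close> on the negative axis, so that the continuous function \<open>r t = \<mu> N t - t\<close> satisfies
\<open>r t = E (r (t - Y))\<close> for \<open>t \<ge> 1\<close>.

A function with this averaging property obeys a maximum principle (\<open>subharmonic_max_principle\<close>): it
never rises above its maximum over a unit window later on. Applied to \<open>r\<close>, to \<open>- r\<close> and to the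
increments of \<open>r\<close>, this shows that \<open>r\<close> is bounded and uniformly continuous. At a late time at
which \<open>r\<close> almost equals its limit superior \<open>L\<close>, full support forces \<open>r\<close> to be close to \<open>L\<close> on the whole
preceding unit window, and the maximum principle for \<open>- r\<close> keeps it close to \<open>L\<close> from then on. So \<open>r\<close>
converges to \<open>L\<close> (\<open>r_convergent\<close>).

Finally, integrating the renewal equation shows that \<open>V t\<close>, the integral of \<open>N\<close> over \<open>[0,t]\<close>, satisfies
\<open>E (V t - V (t - Y)) = t\<close>. Inserting \<open>N s = (s + L + o(1)) / \<mu>\<close> on the window \<open>[t - 1, t]\<close> leaves only
\<open>L \<mu> = E Y\<^sup>2 / 2\<close> (\<open>renewal_asymptotics\<close>).
\<close>

section \<open>Step distributions on the unit interval\<close>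

lemma continuous_on_Icc_bounded:
  fixes g :: "real \<Rightarrow> real"
  assumes "continuous_on {a..b} g"
  obtains B where "\<And>s. s \<in> {a..b} \<Longrightarrow> \<bar>g s\<bar> \<le> B"
proof -
  have "bounded (g ` {a..b})"
    by (intro compact_imp_bounded compact_continuous_image assms) auto
  then obtain B where "\<forall>x\<in>{a..b}. \<bar>g x\<bar> \<le> B" by (auto simp: bounded_iff)
  thus ?thesis by (intro that[of B]) blast
qed

text \<open>The properties of the law of one step that drive the convergence proof. Full support is what
lets a value near the limit superior spread over a whole unit interval; it also forces the law to
be non-lattice. The absence of atoms makes the renewal function continuous after the origin.\<close>

locale unit_step_law = real_distribution \<nu> for \<nu> :: "real measure" +
  assumes AE_unit: "AE y in \<nu>. y \<in> {0..1}"
    and no_atoms: "measure \<nu> {y} = 0"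
    and full_support: "0 \<le> a \<Longrightarrow> a < b \<Longrightarrow> b \<le> 1 \<Longrightarrow> 0 < measure \<nu> {a<..<b}"
begin

definition mean :: real where "mean = (\<integral>y. y \<partial>\<nu>)"

definition second_moment :: real where "second_moment = (\<integral>y. y\<^sup>2 \<partial>\<nu>)"

lemma integrable_unit_bounded:
  fixes g :: "real \<Rightarrow> real"
  assumes "g \<in> borel_measurable borel" "\<And>y. y \<in> {0..1} \<Longrightarrow> \<bar>g y\<bar> \<le> B"
  shows "integrable \<nu> g"
proof (rule integrable_const_bound)
  show "AE y in \<nu>. norm (g y) \<le> B" using AE_unit by eventually_elim (simp add: assms)
  show "g \<in> borel_measurable \<nu>" using assms(1) by measurable
qed

lemma integral_unit_mono:
  fixes g h :: "real \<Rightarrow> real"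
  assumes "integrable \<nu> g" "integrable \<nu> h" "\<And>y. y \<in> {0..1} \<Longrightarrow> g y \<le> h y"
  shows "(\<integral>y. g y \<partial>\<nu>) \<le> (\<integral>y. h y \<partial>\<nu>)"
  by (intro integral_mono_AE assms(1,2), use AE_unit in eventually_elim) (simp add: assms(3))

lemma integrable_ident: "integrable \<nu> (\<lambda>y. y)"
  by (rule integrable_unit_bounded[where B=1]) auto

lemma integrable_square: "integrable \<nu> (\<lambda>y. y\<^sup>2)"
  by (rule integrable_unit_bounded[where B=1]) (auto simp: abs_square_le_1)

lemma mean_pos: "0 < mean"
proof -
  have "0 < 1/2 * measure \<nu> {1/2<..<1}" using full_support[of "1/2" 1] by simp
  also have "\<dots> = (\<integral>y. 1/2 * indicator {1/2<..<1} y \<partial>\<nu>)" by simp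
  also have "\<dots> \<le> mean" unfolding mean_def
    by (rule integral_unit_mono[OF _ integrable_ident])
       (auto split: split_indicator intro!: integrable_unit_bounded[where B=1])
  finally show ?thesis .
qed

lemma integrable_shift:
  fixes g :: "real \<Rightarrow> real"
  assumes [measurable]: "g \<in> borel_measurable borel"
    and g: "continuous_on {a..} g" and t: "a + 1 \<le> t"
  shows "integrable \<nu> (\<lambda>y. g (t - y))"
proof -
  obtain B where B: "\<And>s. s \<in> {a..t} \<Longrightarrow> \<bar>g s\<bar> \<le> B"
    using continuous_on_Icc_bounded[OF continuous_on_subset[OF g, of "{a..t}"]] by auto
  show ?thesis
    by (rule integrable_unit_bounded[where B=B]) (use t in \<open>auto intro!: B\<close>)
qed

text \<open>Compactness of \<open>[0,1]\<close> turns full support into a uniform bound: in a fixed partition into cells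
shorter than \<open>d/2\<close>, every interval of length \<open>d\<close> contains a whole cell, and there are only
finitely many cells.\<close>

lemma interval_mass_lower_bound:
  assumes "0 < d" "d \<le> 1/2"
  obtains c where "0 < c" "\<And>a. 0 \<le> a \<Longrightarrow> a + d \<le> 1 \<Longrightarrow> c \<le> measure \<nu> {a<..<a + d}"
proof -
  obtain n :: nat where n: "2 / d < real n" using reals_Archimedean2 by blast
  have n0: "n > 0" using n assms by (auto intro!: gr0I)
  define J where "J k = {real k / n<..<(real k + 1) / n}" for k
  define c where "c = Min ((\<lambda>k. measure \<nu> (J k)) ` {..<n})"
  have "0 < measure \<nu> (J k)" if "k < n" for k
    unfolding J_def using that n0 by (intro full_support) (auto simp: field_simps)
  hence "0 < c" unfolding c_def using n0 by (subst Min_gr_iff) auto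
  moreover have "c \<le> measure \<nu> {a<..<a + d}" if a: "0 \<le> a" "a + d \<le> 1" for a
  proof -
    define k where "k = nat \<lceil>a * n\<rceil>"
    have k: "a * n \<le> k" "k < a * n + 1" using a n0 unfolding k_def by (auto simp: of_nat_ceiling) linarith
    have dn: "2 < d * n" using n assms by (simp add: field_simps)
    have "(a + d) * n \<le> n" using a n0 by (simp add: mult_left_le_one_le)
    hence "k < n" using k dn by (simp add: distrib_right)
    hence "c \<le> measure \<nu> (J k)" unfolding c_def by (intro Min_le) auto
    also have "\<dots> \<le> measure \<nu> {a<..<a + d}"
    proof (rule finite_measure_mono)
      have "a \<le> k / n" "(real k + 1) / n \<le> a + d" using k dn n0 by (auto simp: field_simps)
      thus "J k \<subseteq> {a<..<a + d}" unfolding J_def by auto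
    qed simp
    finally show ?thesis .
  qed
  ultimately show ?thesis by (rule that)
qed

section \<open>A maximum principle and convergence of harmonic functions\<close>

text \<open>An average over the unit window to the left of \<open>t\<close> cannot exceed the earlier values. Subtracting
the small linear function \<open>e * (t - a)\<close> makes this strict, since averaging over a step
gains \<open>e * mean > 0\<close>; hence the perturbed function attains its maximum on every compact interval
inside the initial window.\<close>

lemma subharmonic_max_principle:
  fixes g :: "real \<Rightarrow> real"
  assumes meas: "g \<in> borel_measurable borel" and cont: "continuous_on {a..} g"
    and sub: "\<And>t. a + 1 \<le> t \<Longrightarrow> g t \<le> (\<integral>y. g (t - y) \<partial>\<nu>)"
    and init: "\<And>t. t \<in> {a..a+1} \<Longrightarrow> g t \<le> C"
    and t: "a \<le> t"
  shows "g t \<le> C"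
proof -
  have main: "g t \<le> C + e * (t - a)" if e: "e > 0" for e
  proof -
    define h where "h s = g s - e * (s - a)" for s
    have "continuous_on {a..t} h" unfolding h_def
      by (intro continuous_intros continuous_on_subset[OF cont]) auto
    then obtain s where s: "s \<in> {a..t}" "\<And>x. x \<in> {a..t} \<Longrightarrow> h x \<le> h s"
      using continuous_attains_sup[of "{a..t}" h] t by auto
    \<comment> \<open>A maximiser outside the initial window would satisfy \<open>g s \<le> g s - e * mean\<close>.\<close>
    have "s \<le> a + 1"
    proof (rule ccontr)
      assume "\<not> s \<le> a + 1"
      hence s1: "a + 1 \<le> s" by simp
      have int: "integrable \<nu> (\<lambda>y. g (s - y))" by (rule integrable_shift[OF meas cont s1])
      have "g s \<le> (\<integral>y. g (s - y) \<partial>\<nu>)" by (rule sub[OF s1])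
      also have "\<dots> \<le> (\<integral>y. h s + e * (s - a) - e * y \<partial>\<nu>)"
      proof (rule integral_unit_mono[OF int])
        show "integrable \<nu> (\<lambda>y. h s + e * (s - a) - e * y)"
          using integrable_ident by auto
        fix y :: real assume "y \<in> {0..1}"
        hence "h (s - y) \<le> h s" using s s1 by auto
        thus "g (s - y) \<le> h s + e * (s - a) - e * y" by (simp add: h_def algebra_simps)
      qed
      also have "\<dots> = g s - e * mean"
        using integrable_ident by (simp add: mean_def h_def prob_space[simplified])
      finally show False using mean_pos e by (simp add: mult_le_0_iff)
    qed
    hence "h s \<le> C" using init[of s] s(1) e unfolding h_def
      by (smt (verit) atLeastAtMost_iff mult_nonneg_nonneg)
    moreover have "h t \<le> h s" using s(2)[of t] t by simp
    ultimately show ?thesis by (simp add: h_def)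
  qed
  show ?thesis
  proof (rule field_le_epsilon)
    fix e :: real assume e: "0 < e"
    have "g t \<le> C + e / (t - a + 1) * (t - a)" using e t by (intro main) simp
    also have "\<dots> \<le> C + e" using e t by (simp add: field_simps)
    finally show "g t \<le> C + e" .
  qed
qed

end

text \<open>The functions that agree, from time 1 on, with their own average over one step backwards. Such a
function is determined by its values on the initial window \<open>[0,1]\<close> and forgets all of them except
one number, its limit.\<close>

locale harmonic_tail = unit_step_law +
  fixes r :: "real \<Rightarrow> real"
  assumes meas_r [measurable]: "r \<in> borel_measurable borel"
    and cont_r: "continuous_on {0..} r"
    and harmonic: "1 \<le> t \<Longrightarrow> r t = (\<integral>y. r (t - y) \<partial>\<nu>)"
begin

lemma integrable_r: "1 \<le> t \<Longrightarrow> integrable \<nu> (\<lambda>y. r (t - y))"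
  by (rule integrable_shift[OF meas_r cont_r]) simp

lemma r_bounded: obtains B where "\<And>t. 0 \<le> t \<Longrightarrow> \<bar>r t\<bar> \<le> B"
proof -
  obtain B where B: "\<And>s. s \<in> {0..1} \<Longrightarrow> \<bar>r s\<bar> \<le> B"
    using continuous_on_Icc_bounded[OF continuous_on_subset[OF cont_r, of "{0..1}"]] by auto
  have "r t \<le> B" if "0 \<le> t" for t
    by (rule subharmonic_max_principle[where a=0, OF meas_r cont_r _ _ that])
       (use B harmonic in \<open>force simp: abs_le_iff\<close>)+
  moreover have "- r t \<le> B" if "0 \<le> t" for t
    by (rule subharmonic_max_principle[where a=0 and g="\<lambda>t. - r t", OF _ _ _ _ that])
       (use B harmonic in \<open>force simp: abs_le_iff intro!: continuous_on_minus cont_r\<close>)+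
  ultimately show ?thesis using that[of B] by (simp add: abs_le_iff)
qed

lemma r_ge_persists:
  assumes "0 \<le> a" "\<And>s. s \<in> {a..a+1} \<Longrightarrow> C \<le> r s" "a \<le> t"
  shows "C \<le> r t"
proof -
  have "- r t \<le> - C"
    by (rule subharmonic_max_principle[where a=a and g="\<lambda>t. - r t", OF _ _ _ _ assms(3)])
       (use assms harmonic in \<open>auto intro!: continuous_on_minus continuous_on_subset[OF cont_r]\<close>)
  thus ?thesis by simp
qed

text \<open>For each fixed shift \<open>h\<close> the increment \<open>\<bar>r (t + h) - r t\<bar>\<close> is subharmonic, so its modulus of
continuity on the initial window is valid on the whole half-line.\<close>

lemma r_uniformly_continuous:
  assumes e: "0 < e"
  obtains d where "0 < d" "\<And>s s'. 0 \<le> s \<Longrightarrow> 0 \<le> s' \<Longrightarrow> \<bar>s - s'\<bar> < d \<Longrightarrow> \<bar>r s - r s'\<bar> \<le> e"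
proof -
  have "uniformly_continuous_on {0..2} r"
    by (intro compact_uniformly_continuous continuous_on_subset[OF cont_r]) auto
  then obtain d where d: "0 < d"
      "\<And>s s'. s \<in> {0..2} \<Longrightarrow> s' \<in> {0..2} \<Longrightarrow> \<bar>s - s'\<bar> < d \<Longrightarrow> \<bar>r s - r s'\<bar> < e"
    using e unfolding uniformly_continuous_on_def dist_real_def by metis
  \<comment> \<open>Shifts below 1 keep \<open>t + h\<close> inside \<open>[0,2]\<close> for \<open>t\<close> in the initial window.\<close>
  have shift: "\<bar>r (t + h) - r t\<bar> \<le> e" if h: "0 \<le> h" "h < min d 1" and t: "0 \<le> t" for h t
  proof (rule subharmonic_max_principle[where a=0 and g="\<lambda>t. \<bar>r (t + h) - r t\<bar>", OF _ _ _ _ t])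
    show "(\<lambda>t. \<bar>r (t + h) - r t\<bar>) \<in> borel_measurable borel" by measurable
    show "continuous_on {0..} (\<lambda>t. \<bar>r (t + h) - r t\<bar>)"
      by (intro continuous_intros cont_r continuous_on_compose2[OF cont_r]) (use h in auto)
    show "\<bar>r (t + h) - r t\<bar> \<le> e" if "t \<in> {0..0+1}" for t
      using d(2)[of "t + h" t] that h by auto
    show "\<bar>r (t + h) - r t\<bar> \<le> (\<integral>y. \<bar>r (t - y + h) - r (t - y)\<bar> \<partial>\<nu>)" if "0 + 1 \<le> t" for t
    proof -
      have i: "integrable \<nu> (\<lambda>y. r (t + h - y))" "integrable \<nu> (\<lambda>y. r (t - y))"
        using that h by (auto intro!: integrable_r)
      have "r (t + h) - r t = (\<integral>y. r (t + h - y) - r (t - y) \<partial>\<nu>)"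
        using harmonic[of "t + h"] harmonic[of t] that h i by simp
      also have "\<bar>\<dots>\<bar> \<le> (\<integral>y. \<bar>r (t + h - y) - r (t - y)\<bar> \<partial>\<nu>)"
        by (rule integral_abs_bound)
      finally show ?thesis by (simp add: algebra_simps)
    qed
  qed
  show ?thesis
  proof (rule that[of "min d 1"])
    show "0 < min d 1" using d by simp
    fix s s' :: real assume "0 \<le> s" "0 \<le> s'" "\<bar>s - s'\<bar> < min d 1"
    thus "\<bar>r s - r s'\<bar> \<le> e"
      using shift[of "s - s'" s'] shift[of "s' - s" s]
      by (cases "s' \<le> s") (auto simp: abs_minus_commute)
  qed
qed

text \<open>The limit superior in the form in which it is used: an eventual upper bound, approached at
arbitrarily late times.\<close>

lemma tail_limsup:
  obtains L where "\<And>e. 0 < e \<Longrightarrow> \<exists>T\<ge>0. \<forall>t\<ge>T. r t \<le> L + e"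
    and "\<And>e T. 0 < e \<Longrightarrow> 0 \<le> T \<Longrightarrow> \<exists>t\<ge>T. L - e < r t"
proof -
  define S where "S = {C. \<exists>T\<ge>0. \<forall>t\<ge>T. r t \<le> C}"
  obtain B where B: "\<And>t. 0 \<le> t \<Longrightarrow> \<bar>r t\<bar> \<le> B" by (rule r_bounded) blast
  have "B \<in> S" using B unfolding S_def by (auto simp: abs_le_iff)
  have bdd: "bdd_below S"
  proof (rule bdd_belowI[of _ "-B"])
    fix C assume "C \<in> S"
    then obtain T where "T \<ge> 0" "r T \<le> C" unfolding S_def by auto
    thus "- B \<le> C" using B[of T] by (simp add: abs_le_iff)
  qed
  show ?thesis
  proof (rule that[of "Inf S"])
    fix e :: real assume "0 < e"
    then obtain C where "C \<in> S" "C < Inf S + e"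
      using cInf_lessD[of S "Inf S + e"] \<open>B \<in> S\<close> by auto
    thus "\<exists>T\<ge>0. \<forall>t\<ge>T. r t \<le> Inf S + e" unfolding S_def by force
  next
    fix e T :: real assume e: "0 < e" and T: "0 \<le> T"
    have "Inf S - e \<notin> S" using cInf_lower[OF _ bdd, of "Inf S - e"] e by auto
    thus "\<exists>t\<ge>T. Inf S - e < r t" using T unfolding S_def mem_Collect_eq not_ex by (meson linorder_not_le)
  qed
qed

text \<open>Let \<open>L\<close> be the limit superior. At a late time \<open>t\<close> with \<open>r t\<close> close to \<open>L\<close>, the average of \<open>r\<close> over
the preceding window is almost its largest possible value. A dip by \<open>e\<close> at a single point of
that window would, by uniform continuity, persist on an interval of length \<open>d\<close>, which carries
mass at least \<open>c\<close>, and would lower the average by about \<open>c * e / 2\<close>. So \<open>r\<close> exceeds \<open>L - e\<close> on the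
whole window, and therefore ever after.\<close>

theorem r_convergent: obtains L where "(r \<longlongrightarrow> L) at_top"
proof -
  obtain L where upper: "\<And>e. 0 < e \<Longrightarrow> \<exists>T\<ge>0. \<forall>t\<ge>T. r t \<le> L + e"
    and often: "\<And>e T. 0 < e \<Longrightarrow> 0 \<le> T \<Longrightarrow> \<exists>t\<ge>T. L - e < r t"
    by (rule tail_limsup) blast
  have lower: "\<exists>T\<ge>0. \<forall>t\<ge>T. L - e \<le> r t" if e: "0 < e" for e
  proof -
    obtain d0 where d0: "0 < d0"
      "\<And>s s'. 0 \<le> s \<Longrightarrow> 0 \<le> s' \<Longrightarrow> \<bar>s - s'\<bar> < d0 \<Longrightarrow> \<bar>r s - r s'\<bar> \<le> e / 2"
      using r_uniformly_continuous[of "e/2"] e by auto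
    define d where "d = min (d0 / 2) (1/2)"
    have d: "0 < d" "d \<le> 1/2" "d < d0" unfolding d_def using d0(1) by auto
    obtain c where c: "0 < c" "\<And>a. 0 \<le> a \<Longrightarrow> a + d \<le> 1 \<Longrightarrow> c \<le> measure \<nu> {a<..<a + d}"
      using interval_mass_lower_bound[OF d(1,2)] by blast
    \<comment> \<open>Small enough that the total deficit \<open>2 * \<eta>\<close> is below the cost \<open>c * e / 2\<close> of a dip.\<close>
    define \<eta> where "\<eta> = c * e / 8"
    have \<eta>: "0 < \<eta>" unfolding \<eta>_def using c e by simp
    obtain T where T: "T \<ge> 0" "\<And>t. t \<ge> T \<Longrightarrow> r t \<le> L + \<eta>" using upper[OF \<eta>] by blast
    obtain t where t: "t \<ge> T + 1" "L - \<eta> < r t" using often[OF \<eta>, of "T + 1"] T(1) by auto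
    have int: "integrable \<nu> (\<lambda>y. L + \<eta> - r (t - y))"
      using integrable_r[of t] t T(1) by auto
    have deficit: "(\<integral>y. L + \<eta> - r (t - y) \<partial>\<nu>) < 2 * \<eta>"
      using integrable_r[of t] harmonic[of t] t T(1) by (simp add: prob_space[simplified])
    have "L - e \<le> r (t - y0)" if y0: "y0 \<in> {0..1}" for y0
    proof (rule ccontr)
      assume *: "\<not> L - e \<le> r (t - y0)"
      \<comment> \<open>Left endpoint of an interval of length \<open>d\<close> in \<open>[0,1]\<close> with \<open>y0\<close> at one of its ends.\<close>
      define a where "a = (if y0 \<le> 1/2 then y0 else y0 - d)"
      have a: "0 \<le> a" "a + d \<le> 1" "\<And>y. y \<in> {a<..<a + d} \<Longrightarrow> \<bar>y - y0\<bar> < d0"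
        using y0 d unfolding a_def by (auto split: if_splits)
      have "c * (e / 2) \<le> measure \<nu> {a<..<a + d} * (e / 2)"
        using c(2)[OF a(1,2)] e by simp
      also have "\<dots> = (\<integral>y. indicator {a<..<a + d} y * (e / 2) \<partial>\<nu>)" by simp
      also have "\<dots> \<le> (\<integral>y. L + \<eta> - r (t - y) \<partial>\<nu>)"
      proof (rule integral_unit_mono[OF _ int])
        fix y :: real assume y: "y \<in> {0..1}"
        show "indicator {a<..<a + d} y * (e / 2) \<le> L + \<eta> - r (t - y)"
        proof (cases "y \<in> {a<..<a + d}")
          case True
          have "\<bar>r (t - y) - r (t - y0)\<bar> \<le> e / 2"
            using a(3)[OF True] y y0 t T(1) by (intro d0(2)) auto
          hence "r (t - y) \<le> r (t - y0) + e / 2" by linarith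
          thus ?thesis using * \<eta> True by simp
        next
          case False
          thus ?thesis using T(2)[of "t - y"] y t by simp
        qed
      qed (intro integrable_mult_left integrable_real_indicator, auto simp: emeasure_eq_measure)
      finally show False using deficit mult_pos_pos[OF c(1) e] unfolding \<eta>_def by linarith
    qed
    note near = this
    have base: "L - e \<le> r s" if "s \<in> {t-1..t-1+1}" for s
      using near[of "t - s"] that by simp
    have "L - e \<le> r s" if "s \<ge> t - 1" for s
      by (rule r_ge_persists[OF _ base that]) (use t T(1) in auto)
    thus ?thesis using t T(1) by (intro exI[of _ "t - 1"]) auto
  qed
  have "(r \<longlongrightarrow> L) at_top"
  proof (rule tendstoI)
    fix e :: real assume e: "0 < e"
    obtain T1 T2 where "\<And>t. t \<ge> T1 \<Longrightarrow> r t \<le> L + e / 2" "\<And>t. t \<ge> T2 \<Longrightarrow> L - e / 2 \<le> r t"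
      using upper[of "e/2"] lower[of "e/2"] e by auto
    thus "\<forall>\<^sub>F t in at_top. dist (r t) L < e"
      by (intro eventually_at_top_linorderI[of "max T1 T2"])
         (use e in \<open>force simp: dist_real_def abs_less_iff\<close>)
  qed
  thus ?thesis by (rule that)
qed

end

section \<open>The renewal function\<close>

context unit_step_law
begin

text \<open>The distribution function of the sum of \<open>n\<close> independent steps, obtained by conditioning on one of
them.\<close>

primrec sum_cdf :: "nat \<Rightarrow> real \<Rightarrow> real" where
  "sum_cdf 0 t = (if 0 \<le> t then 1 else 0)"
| "sum_cdf (Suc n) t = (\<integral>y. sum_cdf n (t - y) \<partial>\<nu>)"

text \<open>The expected number of indices \<open>n\<close>, with 0 included, for which the \<open>n\<close>-th partial sum is at
most \<open>t\<close>. As the partial sums do not decrease, this is the expected index of the first one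
above \<open>t\<close>.\<close>

definition renewal :: "real \<Rightarrow> real" where
  "renewal t = (\<Sum>n. sum_cdf n t)"

lemma sum_cdf_measurable [measurable]: "sum_cdf n \<in> borel_measurable borel"
  by (induction n) auto

lemma sum_cdf_nonneg: "0 \<le> sum_cdf n t"
  by (induction n arbitrary: t) (auto intro: Bochner_Integration.integral_nonneg)

lemma sum_cdf_le_1: "sum_cdf n t \<le> 1"
proof (induction n arbitrary: t)
  case (Suc n)
  have "(\<integral>y. sum_cdf n (t - y) \<partial>\<nu>) \<le> (\<integral>y. 1 \<partial>\<nu>)"
    by (intro integral_mono integrable_unit_bounded[where B=1])
       (auto simp: Suc.IH sum_cdf_nonneg abs_le_iff intro: order_trans[OF _ sum_cdf_nonneg])
  thus ?case by (simp add: prob_space[simplified])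
qed auto

lemma integrable_sum_cdf: "integrable \<nu> (\<lambda>y. sum_cdf n (t - y))"
  by (rule integrable_unit_bounded[where B=1]) (auto simp: abs_of_nonneg sum_cdf_nonneg sum_cdf_le_1)

lemma sum_cdf_negative:
  assumes "t < 0"
  shows "sum_cdf n t = 0"
  using assms
proof (induction n arbitrary: t)
  case (Suc n)
  have "AE y in \<nu>. sum_cdf n (t - y) = 0"
    using AE_unit by eventually_elim (use Suc in auto)
  thus ?case by (simp add: integral_eq_zero_AE)
qed auto

text \<open>The Laplace transform of the step law at 1, which is the base of the exponential Markov bound for
the partial sums.\<close>

definition laplace :: real where "laplace = (\<integral>y. exp (- y) \<partial>\<nu>)"

lemma integrable_exp_minus: "integrable \<nu> (\<lambda>y. exp (- y))"
  by (rule integrable_unit_bounded[where B=1]) auto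

lemma laplace_nonneg: "0 \<le> laplace"
  unfolding laplace_def by (rule Bochner_Integration.integral_nonneg) auto

lemma laplace_less_1: "laplace < 1"
proof -
  have "laplace \<le> (\<integral>y. 1 - y / 2 \<partial>\<nu>)" unfolding laplace_def
  proof (rule integral_unit_mono[OF integrable_exp_minus])
    show "integrable \<nu> (\<lambda>y. 1 - y / 2)" using integrable_ident by auto
    fix y :: real assume y: "y \<in> {0..1}"
    \<comment> \<open>On the unit interval \<open>exp (- y) \<le> 1 / (1 + y) \<le> 1 - y / 2\<close>.\<close>
    have "y * y \<le> y" using y by (simp add: mult_left_le)
    hence "1 \<le> (1 + y) * (1 - y / 2)" by (simp add: algebra_simps)
    also have "\<dots> \<le> exp y * (1 - y / 2)"
      using y exp_ge_add_one_self[of y] by (intro mult_right_mono) auto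
    finally show "exp (- y) \<le> 1 - y / 2" by (simp add: exp_minus field_simps)
  qed
  also have "\<dots> = 1 - mean / 2"
    using integrable_ident by (simp add: mean_def prob_space[simplified])
  finally show ?thesis using mean_pos by simp
qed

text \<open>Markov's inequality for \<open>exp (- S)\<close>, where \<open>S\<close> is the sum of \<open>n\<close> steps. It gives geometric
convergence of the renewal series, uniformly in bounded \<open>t\<close>.\<close>

lemma sum_cdf_chernoff: "sum_cdf n t \<le> exp t * laplace ^ n"
proof (induction n arbitrary: t)
  case (Suc n)
  have "sum_cdf (Suc n) t \<le> (\<integral>y. exp t * laplace ^ n * exp (- y) \<partial>\<nu>)"
    unfolding sum_cdf.simps
  proof (intro integral_mono integrable_sum_cdf integrable_mult_right integrable_exp_minus)
    fix y show "sum_cdf n (t - y) \<le> exp t * laplace ^ n * exp (- y)"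
      using Suc.IH[of "t - y"] by (simp add: exp_diff exp_minus field_simps)
  qed
  also have "\<dots> = exp t * laplace ^ Suc n"
    by (simp add: laplace_def mult_ac)
  finally show ?case .
qed auto

lemma summable_chernoff: "summable (\<lambda>n. exp t * laplace ^ n)"
  using laplace_nonneg laplace_less_1 by (intro summable_mult summable_geometric) auto

lemma summable_sum_cdf: "summable (\<lambda>n. sum_cdf n t)"
  by (rule summable_comparison_test'[OF summable_chernoff[of t], where N=0])
     (simp add: sum_cdf_nonneg sum_cdf_chernoff)

lemma renewal_measurable [measurable]: "renewal \<in> borel_measurable borel"
  unfolding renewal_def[abs_def] by measurable

lemma renewal_nonneg: "0 \<le> renewal t"
  unfolding renewal_def by (intro suminf_nonneg summable_sum_cdf sum_cdf_nonneg)

lemma renewal_negative: "t < 0 \<Longrightarrow> renewal t = 0"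
  by (simp add: renewal_def sum_cdf_negative)

lemma renewal_le_exp: "renewal t \<le> exp t / (1 - laplace)"
proof -
  have "renewal t \<le> (\<Sum>n. exp t * laplace ^ n)"
    unfolding renewal_def
    by (intro suminf_le summable_sum_cdf summable_chernoff sum_cdf_chernoff)
  also have "\<dots> = exp t / (1 - laplace)"
    using laplace_nonneg laplace_less_1 by (simp add: suminf_mult suminf_geometric)
  finally show ?thesis .
qed

text \<open>Split off the term \<open>n = 0\<close> and condition every other term on the first step.\<close>

lemma renewal_equation:
  assumes "0 \<le> t"
  shows "renewal t = 1 + (\<integral>y. renewal (t - y) \<partial>\<nu>)"
proof -
  have "renewal t = sum_cdf 0 t + (\<Sum>n. sum_cdf (Suc n) t)"
    using suminf_split_head[OF summable_sum_cdf[of t]] unfolding renewal_def by linarith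
  also have "(\<Sum>n. sum_cdf (Suc n) t) = (\<integral>y. (\<Sum>n. sum_cdf n (t - y)) \<partial>\<nu>)"
    unfolding sum_cdf.simps
  proof (rule integral_suminf[symmetric])
    show "AE y in \<nu>. summable (\<lambda>n. norm (sum_cdf n (t - y)))"
      using summable_sum_cdf by (simp add: sum_cdf_nonneg)
    show "summable (\<lambda>n. \<integral>y. norm (sum_cdf n (t - y)) \<partial>\<nu>)"
      using summable_sum_cdf[of t] by (subst (asm) summable_Suc_iff[symmetric]) (simp add: sum_cdf_nonneg)
  qed (rule integrable_sum_cdf)
  finally show ?thesis using assms by (simp add: renewal_def)
qed

text \<open>For one step this is the absence of atoms; a further step averages continuous functions and
preserves continuity by dominated convergence.\<close>

lemma sum_cdf_Suc_continuous: "isCont (sum_cdf (Suc n)) t"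
proof (induction n arbitrary: t)
  case 0
  have "sum_cdf (Suc 0) s = cdf \<nu> s" for s
  proof -
    have "sum_cdf (Suc 0) s = (\<integral>y. indicator {..s} y \<partial>\<nu>)"
      by (auto intro!: Bochner_Integration.integral_cong simp: indicator_def)
    thus ?thesis by (simp add: cdf_def)
  qed
  hence "sum_cdf (Suc 0) = cdf \<nu>" by auto
  thus ?case using no_atoms by (simp add: isCont_cdf)
next
  case (Suc n)
  show ?case
  proof (rule continuous_at_sequentiallyI)
    fix u :: "nat \<Rightarrow> real" assume u: "u \<longlonglongrightarrow> t"
    have "(\<lambda>k. \<integral>y. sum_cdf (Suc n) (u k - y) \<partial>\<nu>) \<longlonglongrightarrow> (\<integral>y. sum_cdf (Suc n) (t - y) \<partial>\<nu>)"
    proof (rule integral_dominated_convergence[where w="\<lambda>_. 1"])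
      show "AE y in \<nu>. (\<lambda>k. sum_cdf (Suc n) (u k - y)) \<longlonglongrightarrow> sum_cdf (Suc n) (t - y)"
        by (intro AE_I2 isCont_tendsto_compose[OF Suc.IH] tendsto_intros u)
      show "AE y in \<nu>. norm (sum_cdf (Suc n) (u k - y)) \<le> 1" for k
        unfolding real_norm_def abs_of_nonneg[OF sum_cdf_nonneg] by (simp only: sum_cdf_le_1) simp
    qed (auto simp del: sum_cdf.simps)
    thus "(\<lambda>k. sum_cdf (Suc (Suc n)) (u k)) \<longlonglongrightarrow> sum_cdf (Suc (Suc n)) t"
      by simp
  qed
qed

text \<open>The term \<open>n = 0\<close> jumps at the origin but is constant on the closed half-line, so all terms are
continuous there, and the series converges uniformly on bounded intervals.\<close>

lemma renewal_continuous: "continuous_on {0..} renewal"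
proof -
  have "continuous_on {0..T} renewal" if "0 \<le> T" for T
  proof (rule uniform_limit_theorem)
    show "uniform_limit {0..T} (\<lambda>n t. \<Sum>i<n. sum_cdf i t) renewal sequentially"
      unfolding renewal_def[abs_def]
    proof (rule Weierstrass_m_test[OF _ summable_chernoff[of T]])
      fix n t assume "t \<in> {0..T}"
      hence "exp t * laplace ^ n \<le> exp T * laplace ^ n"
        using laplace_nonneg by (intro mult_right_mono) auto
      thus "norm (sum_cdf n t) \<le> exp T * laplace ^ n"
        using sum_cdf_chernoff[of n t] by (simp add: sum_cdf_nonneg)
    qed
    have "continuous_on {0..T} (sum_cdf n)" for n
    proof (cases n)
      case 0
      thus ?thesis by (auto intro: continuous_on_eq[OF continuous_on_const[of _ 1]])
    next
      case (Suc m)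
      thus ?thesis by (auto simp del: sum_cdf.simps intro!: continuous_at_imp_continuous_on sum_cdf_Suc_continuous)
    qed
    thus "\<forall>\<^sub>F n in sequentially. continuous_on {0..T} (\<lambda>t. \<Sum>i<n. sum_cdf i t)"
      by (intro always_eventually allI continuous_on_sum)
  qed simp
  note cont = this
  show ?thesis
    unfolding continuous_on_eq_continuous_within
  proof
    fix t :: real assume t: "t \<in> {0..}"
    have "continuous (at t within {0..t+1}) renewal"
      using cont[of "t + 1"] t by (auto simp: continuous_on_eq_continuous_within)
    moreover have "at t within {0..t+1} = at t within {0..}"
      by (rule at_within_nhd[of t "{..<t+1}"]) auto
    ultimately show "continuous (at t within {0..}) renewal" by simp
  qed
qed

text \<open>For \<open>t \<ge> 0\<close> this is, by Wald's identity, the expected overshoot of the first partial sum above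
\<open>t\<close>. The linear term turns the constant inhomogeneity of the renewal equation into the harmonicity condition.\<close>

definition discrepancy :: "real \<Rightarrow> real" where
  "discrepancy t = mean * renewal t - t"

lemma integrable_renewal: "1 \<le> t \<Longrightarrow> integrable \<nu> (\<lambda>y. renewal (t - y))"
  by (rule integrable_shift[OF renewal_measurable renewal_continuous]) simp

sublocale harmonic_tail \<nu> discrepancy
proof
  show "discrepancy \<in> borel_measurable borel" unfolding discrepancy_def[abs_def] by measurable
  show "continuous_on {0..} discrepancy" unfolding discrepancy_def[abs_def]
    by (intro continuous_intros renewal_continuous)
  show "discrepancy t = (\<integral>y. discrepancy (t - y) \<partial>\<nu>)" if t: "1 \<le> t" for t
  proof -
    have "(\<integral>y. discrepancy (t - y) \<partial>\<nu>) = mean * (\<integral>y. renewal (t - y) \<partial>\<nu>) - (t - mean)"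
      using integrable_renewal[OF t] integrable_ident unfolding discrepancy_def mean_def
      by (simp add: prob_space[simplified])
    thus ?thesis using renewal_equation[of t] t by (simp add: discrepancy_def algebra_simps)
  qed
qed

section \<open>The value of the limit\<close>

definition integrated_renewal :: "real \<Rightarrow> real" where
  "integrated_renewal t = (LBINT s:{0..t}. renewal s)"

lemma integrated_renewal_measurable [measurable]:
  "integrated_renewal \<in> borel_measurable borel"
proof -
  have "integrated_renewal = (\<lambda>t. \<integral>s. (if 0 \<le> s \<and> s \<le> t then renewal s else 0) \<partial>lborel)"
    unfolding integrated_renewal_def[abs_def] set_lebesgue_integral_def
    by (intro ext Bochner_Integration.integral_cong) (auto simp: indicator_def)
  thus ?thesis by simp
qed

text \<open>The renewal equation integrated over \<open>[0,t]\<close>. Its increments over unit windows involve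
the renewal function only near \<open>t\<close>, which is what allows it to identify the limit.\<close>

lemma integrated_renewal_equation:
  assumes t: "0 \<le> t"
  shows "integrated_renewal t = t + (\<integral>y. integrated_renewal (t - y) \<partial>\<nu>)"
proof -
  interpret P: pair_sigma_finite \<nu> lborel ..
  define h where "h y s = indicator {0..t} s * renewal (s - y)" for y s
  have bound: "\<bar>renewal (s - y)\<bar> \<le> exp t / (1 - laplace)" if "y \<in> {0..1}" "s \<in> {0..t}" for y s
  proof -
    have "renewal (s - y) \<le> exp (s - y) / (1 - laplace)" by (rule renewal_le_exp)
    also have "\<dots> \<le> exp t / (1 - laplace)"
      using that laplace_less_1 by (intro divide_right_mono) auto
    finally show ?thesis by (simp add: renewal_nonneg)
  qed
  have meas: "case_prod h \<in> borel_measurable (\<nu> \<Otimes>\<^sub>M lborel)"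
    unfolding h_def by measurable
  have int: "integrable (\<nu> \<Otimes>\<^sub>M lborel) (case_prod h)"
  proof (rule P.Fubini_integrable[OF meas])
    have slice: "integrable lborel (\<lambda>s. h y s)" if "y \<in> {0..1}" for y
    proof (rule integrableI_bounded_set[where A="{0..t}" and B="exp t / (1 - laplace)"])
      show "AE s in lborel. s \<in> {0..t} \<longrightarrow> norm (h y s) \<le> exp t / (1 - laplace)"
        using bound[OF that] by (auto simp: h_def)
    qed (use t in \<open>auto simp: h_def[abs_def]\<close>)
    show "AE y in \<nu>. integrable lborel (\<lambda>s. case_prod h (y, s))"
      using AE_unit by eventually_elim (simp add: slice)
    show "integrable \<nu> (\<lambda>y. \<integral>s. norm (case_prod h (y, s)) \<partial>lborel)"
    proof (rule integrable_unit_bounded)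
      show "(\<lambda>y. \<integral>s. norm (case_prod h (y, s)) \<partial>lborel) \<in> borel_measurable borel"
        unfolding h_def by measurable
      fix y :: real assume y: "y \<in> {0..1}"
      have "(\<integral>s. norm (h y s) \<partial>lborel) \<le> (\<integral>s. indicator {0..t} s * (exp t / (1 - laplace)) \<partial>lborel)"
        by (intro integral_mono integrable_norm slice[OF y] integrable_mult_left integrable_real_indicator)
           (use bound[OF y] t in \<open>auto simp: h_def indicator_def\<close>)
      thus "\<bar>\<integral>s. norm (case_prod h (y, s)) \<partial>lborel\<bar> \<le> t * (exp t / (1 - laplace))"
        using t by simp
    qed
  qed
  \<comment> \<open>Since the renewal function vanishes on the negative axis, truncating at 0 before or after
    the shift by \<open>y \<ge> 0\<close> makes no difference.\<close>
  have inner: "(\<integral>s. h y s \<partial>lborel) = integrated_renewal (t - y)" if y: "y \<in> {0..1}" for y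
  proof -
    have "integrated_renewal (t - y) = (\<integral>s. indicator {0..t-y} (s - y) * renewal (s - y) \<partial>lborel)"
      using lborel_integral_real_affine[of 1 "\<lambda>s. indicator {0..t-y} s * renewal s" "-y"]
      by (simp add: integrated_renewal_def set_lebesgue_integral_def algebra_simps)
    also have "\<dots> = (\<integral>s. h y s \<partial>lborel)"
      unfolding h_def using y by (intro Bochner_Integration.integral_cong)
        (auto simp: indicator_def renewal_negative)
    finally show ?thesis by simp
  qed
  have "integrated_renewal t = (\<integral>s. indicator {0..t} s * (1 + (\<integral>y. renewal (s - y) \<partial>\<nu>)) \<partial>lborel)"
    unfolding integrated_renewal_def set_lebesgue_integral_def
    by (intro Bochner_Integration.integral_cong) (auto simp: indicator_def renewal_equation)
  also have "\<dots> = (\<integral>s. indicator {0..t} s + (\<integral>y. h y s \<partial>\<nu>) \<partial>lborel)"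
    by (intro Bochner_Integration.integral_cong) (auto simp: indicator_def h_def)
  also have "\<dots> = t + (\<integral>s. (\<integral>y. h y s \<partial>\<nu>) \<partial>lborel)"
    using P.integrable_snd[OF int] t by (subst Bochner_Integration.integral_add) auto
  also have "(\<integral>s. (\<integral>y. h y s \<partial>\<nu>) \<partial>lborel) = (\<integral>y. (\<integral>s. h y s \<partial>lborel) \<partial>\<nu>)"
    by (rule P.Fubini_integral[OF int])
  also have "\<dots> = (\<integral>y. integrated_renewal (t - y) \<partial>\<nu>)"
  proof (rule integral_cong_AE)
    show "(\<lambda>y. \<integral>s. h y s \<partial>lborel) \<in> borel_measurable \<nu>" unfolding h_def by measurable
    show "AE y in \<nu>. (\<integral>s. h y s \<partial>lborel) = integrated_renewal (t - y)"
      using AE_unit by eventually_elim (rule inner)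
  qed measurable
  finally show ?thesis .
qed

text \<open>If \<open>mean * renewal s - s\<close> has limit \<open>L\<close>, then for large \<open>t\<close> the increment \<open>J y\<close> of the integrated
renewal function over \<open>[t - y, t]\<close> is close to \<open>(t * y - y\<^sup>2 / 2 + L * y) / mean\<close>. The integrated
renewal equation says that \<open>J\<close> has expectation exactly \<open>t\<close>; comparing the two forces
\<open>L * mean = second_moment / 2\<close>.\<close>

theorem renewal_asymptotics:
  "((\<lambda>t. renewal t - (t + second_moment / (2 * mean)) / mean) \<longlongrightarrow> 0) at_top"
proof -
  obtain L where L: "(discrepancy \<longlongrightarrow> L) at_top" by (rule r_convergent)
  have "\<bar>second_moment / 2 - L * mean\<bar> \<le> e" if e: "0 < e" for e
  proof -
    have "\<forall>\<^sub>F t in at_top. dist (discrepancy t) L < e" using L e by (rule tendstoD)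
    then obtain T where T: "\<And>t. T \<le> t \<Longrightarrow> \<bar>discrepancy t - L\<bar> \<le> e"
      unfolding eventually_at_top_linorder dist_real_def by (meson less_imp_le)
    define t where "t = max T 0 + 1"
    have t: "1 \<le> t" "T \<le> t - 1" unfolding t_def by auto
    define J where "J y = integrated_renewal t - integrated_renewal (t - y)" for y
    have J: "\<bar>mean * J y - (t * y - y\<^sup>2 / 2 + L * y)\<bar> \<le> e" if y: "y \<in> {0..1}" for y
    proof -
      have cont: "continuous_on {a..b} renewal" if "0 \<le> a" for a b
        using that by (intro continuous_on_subset[OF renewal_continuous]) auto
      have eq: "integrated_renewal s = integral {0..s} renewal" for s
        unfolding integrated_renewal_def
        by (rule set_borel_integral_eq_integral borel_integrable_atLeastAtMost' cont)+ simp
      have "J y = integral {t-y..t} renewal"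
        unfolding J_def eq
        using Henstock_Kurzweil_Integration.integral_combine[where a=0 and c="t - y" and b=t and f=renewal]
          y t integrable_continuous_real[OF cont[of 0 t]]
        by simp
      moreover have "((\<lambda>s. s + L) has_integral (t * y - y\<^sup>2 / 2 + L * y)) {t-y..t}"
      proof -
        have "((\<lambda>s. s + L) has_integral ((t\<^sup>2 / 2 + L * t) - ((t-y)\<^sup>2 / 2 + L * (t-y)))) {t-y..t}"
          using y by (intro fundamental_theorem_of_calculus)
            (auto intro!: derivative_eq_intros simp flip: has_real_derivative_iff_has_vector_derivative)
        moreover have "(t\<^sup>2 / 2 + L * t) - ((t-y)\<^sup>2 / 2 + L * (t-y)) = t * y - y\<^sup>2 / 2 + L * y"
          by (simp add: power2_eq_square field_simps)
        ultimately show ?thesis by simp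
      qed
      ultimately have "((\<lambda>s. mean * renewal s - (s + L)) has_integral
          mean * J y - (t * y - y\<^sup>2 / 2 + L * y)) {t-y..t}"
        using integrable_integral[OF integrable_continuous_real[OF cont[of "t-y" t]]] y t
        by (intro has_integral_diff has_integral_mult_right) auto
      hence "mean * J y - (t * y - y\<^sup>2 / 2 + L * y) = integral {t-y..t} (\<lambda>s. discrepancy s - L)"
        by (simp add: integral_unique discrepancy_def diff_diff_eq)
      also have "\<bar>\<dots>\<bar> \<le> e * (t - (t - y))"
        unfolding real_norm_def[symmetric]
      proof (rule integral_bound)
        show "continuous_on {t - y..t} (\<lambda>s. discrepancy s - L)"
          using y t by (intro continuous_intros continuous_on_subset[OF cont_r]) auto
        show "norm (discrepancy s - L) \<le> e" if "s \<in> {t-y..t}" for s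
          using T[of s] that y t by auto
      qed (use y in auto)
      also have "\<dots> \<le> e" using y e by (simp add: mult_left_le)
      finally show ?thesis .
    qed
    have intJ: "integrable \<nu> J"
    proof (rule integrable_unit_bounded)
      show "J \<in> borel_measurable borel" unfolding J_def by measurable
      fix y :: real assume y: "y \<in> {0..1}"
      have "\<bar>t * y\<bar> \<le> t" "\<bar>y\<^sup>2\<bar> \<le> 1" "\<bar>L * y\<bar> \<le> \<bar>L\<bar>"
        using y t by (auto simp: abs_mult mult_left_le abs_square_le_1)
      hence "\<bar>mean * J y\<bar> \<le> e + t + 1 + \<bar>L\<bar>" using J[OF y] by linarith
      thus "\<bar>J y\<bar> \<le> (e + t + 1 + \<bar>L\<bar>) / mean"
        using mean_pos by (simp add: abs_mult field_simps)
    qed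
    have "(\<integral>y. integrated_renewal (t - y) \<partial>\<nu>) = (\<integral>y. integrated_renewal t - J y \<partial>\<nu>)"
      by (simp add: J_def)
    hence "(\<integral>y. J y \<partial>\<nu>) = t"
      using integrated_renewal_equation[of t] t intJ by (simp add: prob_space[simplified])
    hence "second_moment / 2 - L * mean
        = (\<integral>y. mean * J y - (t * y - y\<^sup>2 / 2 + L * y) \<partial>\<nu>)"
      using intJ integrable_ident integrable_square
      by (simp add: second_moment_def mean_def algebra_simps)
    also have "\<bar>\<dots>\<bar> \<le> (\<integral>y. \<bar>mean * J y - (t * y - y\<^sup>2 / 2 + L * y)\<bar> \<partial>\<nu>)"
      by (rule integral_abs_bound)
    also have "\<dots> \<le> (\<integral>y. e \<partial>\<nu>)"
      using J intJ integrable_ident integrable_square by (intro integral_unit_mono) auto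
    finally show ?thesis by (simp add: prob_space[simplified])
  qed
  hence "\<bar>second_moment / 2 - L * mean\<bar> \<le> 0" by (rule field_le_epsilon) (simp add: algebra_simps)
  hence "L = second_moment / (2 * mean)" using mean_pos by (simp add: field_simps)
  hence "((\<lambda>t. (discrepancy t - second_moment / (2 * mean)) / mean) \<longlongrightarrow> 0 / mean) at_top"
    using L mean_pos by (intro tendsto_divide LIM_zero) auto
  thus ?thesis using mean_pos by (simp add: discrepancy_def field_simps)
qed

end

section \<open>The stopping time\<close>

text \<open>With nonnegative summands the partial sums do not decrease, so the tail events of the
stopping time are events about single partial sums. For \<open>k = 0\<close> the right-hand side
is \<open>0 \<le> t\<close>, in accordance with the stopping time being at least 1.\<close>

lemma less_stop_time_iff:
  assumes "\<And>i. 1 \<le> i \<Longrightarrow> 0 \<le> f (X i \<omega>)" and "0 \<le> t"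
  shows "enat k < stop_time f X t \<omega> \<longleftrightarrow> (\<Sum>i=1..k. f (X i \<omega>)) \<le> t"
proof -
  have mono: "(\<Sum>i=1..j. f (X i \<omega>)) \<le> (\<Sum>i=1..k. f (X i \<omega>))" if "j \<le> k" for j
    using that assms(1) by (intro sum_mono2) auto
  have "enat k < stop_time f X t \<omega> \<longleftrightarrow> (\<forall>j. 1 \<le> j \<and> t < (\<Sum>i=1..j. f (X i \<omega>)) \<longrightarrow> k < j)"
    unfolding stop_time_def Suc_ile_eq[symmetric] le_INF_iff by (auto simp: Suc_le_eq)
  also have "\<dots> \<longleftrightarrow> (\<Sum>i=1..k. f (X i \<omega>)) \<le> t"
  proof
    assume *: "\<forall>j. 1 \<le> j \<and> t < (\<Sum>i=1..j. f (X i \<omega>)) \<longrightarrow> k < j"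
    show "(\<Sum>i=1..k. f (X i \<omega>)) \<le> t"
    proof (cases "k = 0")
      case False
      thus ?thesis using spec[OF *, of k] by (intro leI notI) simp
    qed (use assms(2) in simp)
  next
    assume *: "(\<Sum>i=1..k. f (X i \<omega>)) \<le> t"
    show "\<forall>j. 1 \<le> j \<and> t < (\<Sum>i=1..j. f (X i \<omega>)) \<longrightarrow> k < j"
    proof (intro allI impI, rule ccontr)
      fix j assume "1 \<le> j \<and> t < (\<Sum>i=1..j. f (X i \<omega>))" "\<not> k < j"
      thus False using * mono[of j] by simp
    qed
  qed
  finally show ?thesis .
qed

lemma enat_eqI:
  fixes a b :: enat
  assumes "\<And>k. enat k < a \<longleftrightarrow> enat k < b"
  shows "a = b"
proof (rule ccontr)
  assume "a \<noteq> b"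
  thus False using assms[of "the_enat (min a b)"] by (cases a; cases b) (auto simp: min_def split: if_splits)
qed

locale renewal_process = unit_step_law \<nu> + M: prob_space M
  for \<nu> :: "real measure" and M :: "'a measure" +
  fixes f :: "real \<Rightarrow> real" and X :: "nat \<Rightarrow> 'a \<Rightarrow> real"
  assumes indep_steps: "M.indep_vars (\<lambda>_. borel) (\<lambda>i \<omega>. f (X i \<omega>)) {1..}"
    and distr_step: "1 \<le> i \<Longrightarrow> distr M borel (\<lambda>\<omega>. f (X i \<omega>)) = \<nu>"
    and step_nonneg: "1 \<le> i \<Longrightarrow> \<omega> \<in> space M \<Longrightarrow> 0 \<le> f (X i \<omega>)"
begin

lemma step_measurable: "1 \<le> i \<Longrightarrow> (\<lambda>\<omega>. f (X i \<omega>)) \<in> borel_measurable M"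
  using indep_steps unfolding M.indep_vars_def by auto

lemma partial_sum_measurable [measurable]:
  "(\<lambda>\<omega>. \<Sum>i=1..n. f (X i \<omega>)) \<in> borel_measurable M"
  by (intro borel_measurable_sum step_measurable) auto

lemma partial_sum_law:
  "emeasure M {\<omega> \<in> space M. (\<Sum>i=1..n. f (X i \<omega>)) \<le> t} = ennreal (sum_cdf n t)"
proof (induction n arbitrary: t)
  case 0
  thus ?case by (simp add: M.emeasure_space_1)
next
  case (Suc n)
  define S where "S \<omega> = (\<Sum>i=1..n. f (X i \<omega>))" for \<omega>
  define Y where "Y \<omega> = f (X (Suc n) \<omega>)" for \<omega>
  have [measurable]: "S \<in> borel_measurable M"
    unfolding S_def[abs_def] by (rule partial_sum_measurable)
  have [measurable]: "Y \<in> borel_measurable M"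
    unfolding Y_def[abs_def] by (rule step_measurable) simp
  have "M.indep_var borel Y borel S"
    unfolding Y_def[abs_def] S_def[abs_def]
    by (rule M.indep_vars_sum[where X="\<lambda>i \<omega>. f (X i \<omega>)" and i="Suc n" and I="{1..n}"])
       (auto intro: M.indep_vars_subset[OF indep_steps])
  hence "distr M borel (\<lambda>\<omega>. Y \<omega> + S \<omega>) = convolution (distr M borel Y) (distr M borel S)"
    by (rule M.sum_indep_random_variable) measurable
  also have "distr M borel Y = \<nu>"
    unfolding Y_def[abs_def] by (rule distr_step) simp
  finally have conv: "distr M borel (\<lambda>\<omega>. Y \<omega> + S \<omega>) = convolution \<nu> (distr M borel S)" .
  have "emeasure M {\<omega> \<in> space M. (\<Sum>i=1..Suc n. f (X i \<omega>)) \<le> t}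
      = emeasure (distr M borel (\<lambda>\<omega>. Y \<omega> + S \<omega>)) {..t}"
    by (subst emeasure_distr, measurable)
       (auto simp: Y_def S_def add.commute intro!: arg_cong[where f="emeasure M"])
  also have "\<dots> = (\<integral>\<^sup>+y. emeasure (distr M borel S) {s. s + y \<in> {..t}} \<partial>\<nu>)"
    unfolding conv
    by (rule convolution_emeasure) (auto intro: finite_measure_axioms M.finite_measure_distr)
  also have "\<dots> = (\<integral>\<^sup>+y. ennreal (sum_cdf n (t - y)) \<partial>\<nu>)"
  proof (rule nn_integral_cong)
    fix y
    have "{s. s + y \<in> {..t}} = {..t - y}" by auto
    hence "emeasure (distr M borel S) {s. s + y \<in> {..t}} = emeasure M (S -` {..t - y} \<inter> space M)"
      by (simp add: emeasure_distr)
    also have "S -` {..t - y} \<inter> space M = {\<omega> \<in> space M. S \<omega> \<le> t - y}" by auto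
    finally show "emeasure (distr M borel S) {s. s + y \<in> {..t}} = ennreal (sum_cdf n (t - y))"
      using Suc.IH[of "t - y"] by (simp only: S_def[abs_def])
  qed
  also have "\<dots> = ennreal (sum_cdf (Suc n) t)"
    using integrable_sum_cdf sum_cdf_nonneg by (simp add: nn_integral_eq_integral)
  finally show ?case .
qed

lemma stop_time_tail_sets:
  assumes "0 \<le> t"
  shows "{\<omega> \<in> space M. enat k < stop_time f X t \<omega>} \<in> sets M"
proof -
  have "{\<omega> \<in> space M. enat k < stop_time f X t \<omega>}
      = {\<omega> \<in> space M. (\<Sum>i=1..k. f (X i \<omega>)) \<le> t}"
    by (intro Collect_cong conj_cong refl less_stop_time_iff step_nonneg assms)
  also have "\<dots> \<in> sets M"
    by (rule iffD1[OF borel_measurable_iff_le partial_sum_measurable, rule_format])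
  finally show ?thesis .
qed

lemma stop_time_measurable:
  assumes "0 \<le> t"
  shows "stop_time f X t \<in> measurable M (count_space UNIV)"
proof -
  let ?K = "stop_time f X t"
  note tail = stop_time_tail_sets[OF assms]
  have "?K -` {a} \<inter> space M \<in> sets M" for a
  proof -
    have "{\<omega> \<in> space M. (enat k < ?K \<omega>) = (enat k < a)} \<in> sets M" for k
    proof (cases "enat k < a")
      case True
      thus ?thesis using tail[of k] by (simp only: simp_thms)
    next
      case False
      thus ?thesis using sets.sets_Collect_neg[OF tail[of k]] by (simp only: simp_thms)
    qed
    hence "{\<omega> \<in> space M. \<forall>k. (enat k < ?K \<omega>) = (enat k < a)} \<in> sets M"
      by (rule sets.sets_Collect_countable_All)
    also have "{\<omega> \<in> space M. \<forall>k. (enat k < ?K \<omega>) = (enat k < a)} = ?K -` {a} \<inter> space M"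
      by (auto intro: enat_eqI)
    finally show ?thesis .
  qed
  thus ?thesis by (simp add: measurable_count_space_eq2_countable)
qed

text \<open>The tail-sum formula for the expectation of a random variable with values in the extended
naturals. It covers the event that the level is never exceeded without separate treatment.\<close>

lemma expected_stop_eq_renewal:
  assumes t: "0 \<le> t"
  shows "expected_stop M f X t = ennreal (renewal t)"
proof -
  have "expected_stop M f X t = (\<Sum>k. emeasure M {\<omega> \<in> space M. enat k < stop_time f X t \<omega>})"
    unfolding expected_stop_def by (rule nn_integral_enat_function[OF stop_time_measurable[OF t]])
  also have "\<dots> = (\<Sum>k. ennreal (sum_cdf k t))"
    unfolding partial_sum_law[symmetric]
    by (intro suminf_cong arg_cong[where f="emeasure M"] Collect_cong conj_cong refl
        less_stop_time_iff step_nonneg t)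
  also have "\<dots> = ennreal (renewal t)"
    unfolding renewal_def
    by (intro suminf_ennreal_eq summable_sums summable_sum_cdf sum_cdf_nonneg)
  finally show ?thesis .
qed

end

section \<open>Increasing bijections of the unit interval\<close>

locale unit_bijection =
  fixes f :: "real \<Rightarrow> real"
  assumes mono: "mono_on {0..1} f" and bij: "bij_betw f {0..1} {0..1}"
begin

text \<open>Continuing \<open>f\<close> by the identity gives a monotone surjection of the real line onto itself. Hence it
is continuous, and Borel measurable, although \<open>f\<close> is arbitrary outside the unit interval.\<close>

definition extension :: "real \<Rightarrow> real" where
  "extension x = (if x \<in> {0..1} then f x else x)"

lemma f_unit: "x \<in> {0..1} \<Longrightarrow> f x \<in> {0..1}"
  using bij by (auto simp: bij_betw_def)

lemma extension_eq: "x \<in> {0..1} \<Longrightarrow> extension x = f x"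
  by (simp add: extension_def)

lemma extension_mono: "x \<le> y \<Longrightarrow> extension x \<le> extension y"
  using f_unit[of x] f_unit[of y] mono_onD[OF mono, of x y]
  by (auto simp: extension_def)

abbreviation inverse_f :: "real \<Rightarrow> real" where
  "inverse_f \<equiv> inv_into {0..1} f"

lemma inverse_f_unit: "u \<in> {0..1} \<Longrightarrow> inverse_f u \<in> {0..1}"
  using bij_betw_apply[OF bij_betw_inv_into[OF bij]] .

lemma f_inverse_f: "u \<in> {0..1} \<Longrightarrow> f (inverse_f u) = u"
  using bij by (simp add: bij_betw_inv_into_right)

lemma extension_continuous: "continuous_on UNIV extension"
proof (rule continuous_onI_mono)
  have "u \<in> range extension" for u
  proof (cases "u \<in> {0..1}")
    case True
    hence "extension (inverse_f u) = u"
      using inverse_f_unit f_inverse_f by (simp add: extension_def)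
    thus ?thesis by (metis rangeI)
  next
    case False
    hence "extension u = u" by (simp only: extension_def if_False)
    thus ?thesis by (metis rangeI)
  qed
  hence "range extension = UNIV" by blast
  thus "open (range extension)" by simp
qed (rule extension_mono)

lemma f_continuous: "continuous_on {0..1} f"
  by (rule continuous_on_eq[OF continuous_on_subset[OF extension_continuous]])
     (auto simp: extension_eq)

lemma extension_measurable [measurable]: "extension \<in> borel_measurable borel"
  by (rule borel_measurable_continuous_onI[OF extension_continuous])

lemma f_less_iff:
  assumes "x \<in> {0..1}" "y \<in> {0..1}"
  shows "f x < f y \<longleftrightarrow> x < y"
  using mono_onD[OF mono assms] mono_onD[OF mono assms(2,1)] assms
    inj_onD[OF bij_betw_imp_inj_on[OF bij] _ assms]
  by (smt (verit))

lemma less_f_iff: "u \<in> {0..1} \<Longrightarrow> x \<in> {0..1} \<Longrightarrow> u < f x \<longleftrightarrow> inverse_f u < x"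
  using f_less_iff[OF inverse_f_unit] f_inverse_f by metis

lemma f_less_iff': "u \<in> {0..1} \<Longrightarrow> x \<in> {0..1} \<Longrightarrow> f x < u \<longleftrightarrow> x < inverse_f u"
  using f_less_iff[OF _ inverse_f_unit] f_inverse_f by metis

text \<open>The law of \<open>f (U)\<close> for a uniformly distributed \<open>U\<close>; its distribution function on \<open>[0,1]\<close> is the
inverse of \<open>f\<close>.\<close>

definition step_law :: "real measure" where
  "step_law = distr (uniform_measure lborel {0..1}) borel extension"

lemma prob_space_uniform: "prob_space (uniform_measure lborel {0..1::real})"
  by (rule prob_space_uniform_measure) auto

lemma measure_step_law:
  assumes "A \<in> sets borel"
  shows "measure step_law A = measure lborel ({0..1} \<inter> extension -` A)"
proof -
  have "extension -` A \<in> sets borel"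
    using measurable_sets[OF extension_measurable assms] by simp
  thus ?thesis using assms
    by (simp add: step_law_def measure_distr measure_uniform_measure)
qed

lemma integral_step_law:
  fixes g :: "real \<Rightarrow> real"
  assumes "continuous_on UNIV g"
  shows "(\<integral>y. g y \<partial>step_law) = integral {0..1} (\<lambda>x. g (f x))"
proof -
  have [measurable]: "g \<in> borel_measurable borel"
    by (rule borel_measurable_continuous_onI[OF assms])
  have c: "continuous_on {0..1} (\<lambda>x. g (extension x))"
    by (intro continuous_on_compose2[OF assms] continuous_on_subset[OF extension_continuous]) auto
  have "(\<integral>y. g y \<partial>step_law) = (\<integral>x. g (extension x) \<partial>uniform_measure lborel {0..1})"
    unfolding step_law_def by (rule Bochner_Integration.integral_distr) auto
  also have "\<dots> = (LBINT x:{0..1}. g (extension x))"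
  proof -
    have "uniform_measure lborel {0..1::real} = density lborel (\<lambda>x. ennreal (indicator {0..1} x))"
      unfolding uniform_measure_def by (simp add: divide_ennreal_def ennreal_indicator)
    thus ?thesis by (simp add: integral_density set_lebesgue_integral_def)
  qed
  also have "\<dots> = integral {0..1} (\<lambda>x. g (extension x))"
    by (rule set_borel_integral_eq_integral borel_integrable_atLeastAtMost' c)+
  also have "\<dots> = integral {0..1} (\<lambda>x. g (f x))"
    by (intro integral_cong) (simp add: extension_eq)
  finally show ?thesis .
qed

text \<open>Injectivity of \<open>f\<close> excludes atoms. The mass of an interval \<open>(a,b)\<close> is the length of its
preimage \<open>(inverse_f a, inverse_f b)\<close>, which is positive by strict monotonicity.\<close>

sublocale unit_step_law step_law
proof -
  interpret P: prob_space step_law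
    unfolding step_law_def by (rule prob_space.prob_space_distr[OF prob_space_uniform]) auto
  show "unit_step_law step_law"
  proof
    show "sets step_law = sets borel" by (simp add: step_law_def)
    have "measure step_law {0..1} = 1"
    proof -
      have "{0..1} \<inter> extension -` {0..1} = {0..1}" using f_unit by (auto simp: extension_def)
      thus ?thesis by (simp add: measure_step_law)
    qed
    thus "AE y in step_law. y \<in> {0..1}"
      by (subst (asm) P.prob_eq_1) (auto simp: step_law_def)
    show "measure step_law {y} = 0" for y
    proof -
      have "inj_on extension {0..1}"
        using bij by (auto simp: bij_betw_def inj_on_def extension_def)
      hence "finite ({0..1} \<inter> extension -` {y})"
        using finite_vimage_IntI[of "{y}" extension "{0..1}"] by (simp add: Int_commute)
      hence "emeasure lborel ({0..1} \<inter> extension -` {y}) = 0"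
        by (intro emeasure_lborel_countable countable_finite)
      thus ?thesis using measure_step_law[of "{y}"] by (simp add: measure_def)
    qed
    show "0 < measure step_law {a<..<b}" if "0 \<le> a" "a < b" "b \<le> 1" for a b
    proof -
      have ab: "a \<in> {0..1}" "b \<in> {0..1}" using that by auto
      have "{0..1} \<inter> extension -` {a<..<b} = {inverse_f a<..<inverse_f b}"
        using inverse_f_unit[OF ab(1)] inverse_f_unit[OF ab(2)]
        by (auto simp: extension_eq less_f_iff[OF ab(1)] f_less_iff'[OF ab(2)])
      moreover have "inverse_f a < inverse_f b"
        using f_less_iff[OF inverse_f_unit[OF ab(1)] inverse_f_unit[OF ab(2)]] that ab
        by (simp add: f_inverse_f)
      ultimately show ?thesis by (simp add: measure_step_law)
    qed
  qed
qed

text \<open>For a step \<open>Y\<close> the left-hand side is \<open>\<integral> E (max 0 (Y - u)) du\<close>, because \<open>f x \<ge> u\<close> exactly for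
\<open>x \<ge> inverse_f u\<close>. The integrand \<open>max 0 (f x - u)\<close> is continuous on the unit square, so the
order of integration may be exchanged, and the integral over \<open>u\<close> is \<open>Y\<^sup>2 / 2\<close>.\<close>

lemma integral_overshoot_square:
  "(LBINT u:{0..1}. (LBINT x:{inverse_f u..1}. f x - u)) = second_moment / 2"
proof -
  define g where "g u x = max 0 (f x - u)" for u x
  have cont: "continuous_on ({0..1} \<times> {0..1}) (\<lambda>(u, x). g u x)"
    unfolding g_def split_beta
    by (intro continuous_intros continuous_on_compose2[OF f_continuous]) auto
  have inner: "(LBINT x:{inverse_f u..1}. f x - u) = integral {0..1} (g u)" if u: "u \<in> {0..1}" for u
  proof -
    have i: "inverse_f u \<in> {0..1}" by (rule inverse_f_unit[OF u])
    have "(LBINT x:{inverse_f u..1}. f x - u) = integral {inverse_f u..1} (\<lambda>x. f x - u)"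
      by (intro set_borel_integral_eq_integral borel_integrable_atLeastAtMost'
            continuous_intros continuous_on_subset[OF f_continuous]) (use i in auto)
    also have "\<dots> = integral {inverse_f u..1} (g u)"
    proof (rule integral_cong)
      fix x assume x: "x \<in> {inverse_f u..1}"
      hence "\<not> f x < u" using i u by (subst f_less_iff') auto
      thus "f x - u = g u x" by (simp add: g_def)
    qed
    also have "\<dots> = integral {0..1} (g u)"
    proof -
      have "integral {0..inverse_f u} (g u) = 0"
      proof (rule integral_unique[OF has_integral_is_0])
        fix x assume "x \<in> {0..inverse_f u}"
        hence "\<not> u < f x" using i u by (subst less_f_iff) auto
        thus "g u x = 0" by (simp add: g_def)
      qed
      moreover have "g u integrable_on {0..1}"
        unfolding g_def
        by (intro integrable_continuous_real continuous_intros f_continuous)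
      ultimately show ?thesis
        using Henstock_Kurzweil_Integration.integral_combine[where a=0 and c="inverse_f u" and b=1 and f="g u"] i
        by simp
    qed
    finally show ?thesis .
  qed
  have "(LBINT u:{0..1}. (LBINT x:{inverse_f u..1}. f x - u)) = (LBINT u:{0..1}. integral {0..1} (g u))"
    by (intro set_lebesgue_integral_cong) (auto simp: inner)
  also have "\<dots> = integral {0..1} (\<lambda>u. integral {0..1} (g u))"
  proof -
    have "continuous_on {0..1} (\<lambda>u. integral (cbox 0 1) (g u))"
      using cont by (intro integral_continuous_on_param) simp
    thus ?thesis
      by (intro set_borel_integral_eq_integral borel_integrable_atLeastAtMost') simp
  qed
  also have "\<dots> = integral {0..1} (\<lambda>x. integral {0..1} (\<lambda>u. g u x))"
    using integral_swap_continuous[of 0 0 1 1 g] cont by (simp add: cbox_Pair_eq)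
  also have "\<dots> = integral {0..1} (\<lambda>x. (f x)\<^sup>2 / 2)"
  proof (rule integral_cong)
    fix x :: real assume x: "x \<in> {0..1}"
    have fx: "0 \<le> f x" "f x \<le> 1" using f_unit[OF x] by auto
    have "((\<lambda>u. f x - u) has_integral ((f x * f x - (f x)\<^sup>2 / 2) - (f x * 0 - 0\<^sup>2 / 2))) {0..f x}"
      using fx by (intro fundamental_theorem_of_calculus)
        (auto intro!: derivative_eq_intros simp flip: has_real_derivative_iff_has_vector_derivative)
    hence "((\<lambda>u. g u x) has_integral ((f x)\<^sup>2 / 2)) {0..f x}"
      by (rule has_integral_eq_rhs[OF has_integral_eq, rotated])
         (auto simp: g_def power2_eq_square)
    moreover have "((\<lambda>u. g u x) has_integral 0) {f x..1}"
      by (rule has_integral_is_0) (auto simp: g_def)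
    ultimately have "((\<lambda>u. g u x) has_integral ((f x)\<^sup>2 / 2 + 0)) {0..1}"
      using fx by (intro has_integral_combine)
    thus "integral {0..1} (\<lambda>u. g u x) = (f x)\<^sup>2 / 2" by (simp add: integral_unique)
  qed
  also have "\<dots> = second_moment / 2"
    unfolding second_moment_def by (subst integral_step_law) (auto intro!: continuous_intros)
  finally show ?thesis .
qed

end

theorem theorem1:
  fixes M :: "'a measure" and f :: "real \<Rightarrow> real" and X :: "nat \<Rightarrow> 'a \<Rightarrow> real"
  assumes "mono_on {0..1} f" and "bij_betw f {0..1} {0..1}"
    and "prob_space M"
    and "prob_space.indep_vars M (\<lambda>_. borel) X {1..}"
    and "\<And>i. i \<ge> 1 \<Longrightarrow> distr M borel (X i) = uniform_measure lborel {0..1}"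
    and "\<And>i \<omega>. i \<ge> 1 \<Longrightarrow> \<omega> \<in> space M \<Longrightarrow> X i \<omega> \<in> {0..1}"
  shows "(\<forall>t\<ge>0. expected_stop M f X t < \<infinity>) \<and>
    (\<lambda>t. enn2real (expected_stop M f X t) - (t + c_const M f X) / mean_step M f X)
      \<in> o[at_top](\<lambda>_. 1)"
proof -
  interpret M: prob_space M by fact
  interpret unit_bijection f by unfold_locales fact+
  have X_meas: "X i \<in> borel_measurable M" if "1 \<le> i" for i
    using assms(4) that unfolding M.indep_vars_def by auto
  have step_eq: "f (X i \<omega>) = extension (X i \<omega>)" if "1 \<le> i" "\<omega> \<in> space M" for i \<omega>
    using assms(6)[OF that] by (simp add: extension_eq)
  have law: "distr M borel (\<lambda>\<omega>. extension (X i \<omega>)) = step_law" if i: "1 \<le> i" for i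
    using distr_distr[OF extension_measurable X_meas[OF i]] assms(5)[OF i]
    by (simp add: step_law_def comp_def)
  have indep: "M.indep_vars (\<lambda>_. borel) (\<lambda>i \<omega>. extension (X i \<omega>)) {1..}"
    by (rule M.indep_vars_compose2[OF assms(4)]) simp
  have nonneg: "0 \<le> extension (X i \<omega>)" if "1 \<le> i" "\<omega> \<in> space M" for i \<omega>
    using step_eq[OF that] f_unit[OF assms(6)[OF that]] by simp
  \<comment> \<open>The process is driven by the extension of \<open>f\<close>, which is measurable on the whole line and
    agrees with \<open>f\<close> at all values of the \<open>X i\<close> with \<open>i \<ge> 1\<close>.\<close>
  interpret renewal_process step_law M extension X
    by unfold_locales (fact indep law nonneg)+
  have "expected_stop M f X t = expected_stop M extension X t" for t
    unfolding expected_stop_def stop_time_def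
    by (intro nn_integral_cong arg_cong[where f=ennreal_of_enat] INF_cong Collect_cong)
       (simp_all add: step_eq)
  hence expected_stop_f: "expected_stop M f X t = ennreal (renewal t)" if "0 \<le> t" for t
    using expected_stop_eq_renewal[OF that] by simp
  have mean_eq: "mean_step M f X = mean"
  proof -
    have "mean = (\<integral>y. y \<partial>distr M borel (\<lambda>\<omega>. extension (X 1 \<omega>)))"
      by (simp add: mean_def law)
    also have "\<dots> = (\<integral>\<omega>. extension (X 1 \<omega>) \<partial>M)"
      by (rule Bochner_Integration.integral_distr) (auto intro: step_measurable)
    also have "\<dots> = (\<integral>\<omega>. f (X 1 \<omega>) \<partial>M)"
      by (rule Bochner_Integration.integral_cong) (simp_all add: step_eq)
    finally show ?thesis by (simp add: mean_step_def)
  qed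
  have c_eq: "c_const M f X = second_moment / (2 * mean)"
    unfolding c_const_def mean_eq integral_overshoot_square by simp
  have "\<forall>\<^sub>F t in at_top. enn2real (expected_stop M f X t) = renewal t"
    using eventually_ge_at_top[of 0]
    by eventually_elim (simp add: expected_stop_f renewal_nonneg)
  hence "((\<lambda>t. enn2real (expected_stop M f X t) - (t + c_const M f X) / mean_step M f X) \<longlongrightarrow> 0) at_top"
    unfolding c_eq mean_eq
    by (intro Lim_transform_eventually[OF renewal_asymptotics]) (auto elim: eventually_mono)
  hence "(\<lambda>t. enn2real (expected_stop M f X t) - (t + c_const M f X) / mean_step M f X)
      \<in> o[at_top](\<lambda>_. 1)"
    by (intro smalloI_tendsto) auto
  thus ?thesis by (simp add: expected_stop_f)
qed

end
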